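(* Let $f,g,h:\mathbb{R}^n\to\mathbb{R}$ be quadratic functions, $f(x)=x^TAx+2a^Tx+a_0$, $g(x)=x^TBx+2b^Tx+b_0$, $h(x)=x^TCx+2c^Tx+c_0$, with $A,B,C\in\mathbb{R}^{n\times n}$ symmetric, $a,b,c\in\mathbb{R}^n$ and $a_0,b_0,c_0\in\mathbb{R}$. Under Assumptions 1, 2, 3, 4 and 5 (stated in the context), neither of the two systems $$\begin{cases} g(x)>0,\\ h(x)\ge 0;\end{cases}\qquad\text{and}\qquad \begin{cases} g(x)\ge 0,\\ h(x)>0\end{cases}$$ has a solution $x\in\mathbb{R}^n$. In other words, $\big(\{g>0\}\cap\{h\ge 0\}\big)\cup\big(\{g\ge 0\}\cap\{h>0\}\big)=\emptyset$.
   Context: For $\phi:\mathbb{R}^n\to\mathbb{R}$ and $\star\in\{<,\le,=,\ge,>\}$ write $\{\phi\star 0\}=\{x\in\mathbb{R}^n:\phi(x)\star 0\}$. A quadratic function is one of the form $x^TMx+2m^Tx+m_0$ with $M$ a symmetric matrix (possibly indefinite, possibly zero). Let $\mathcal{D}=\{g\le 0\}\cap\{h\le 0\}$. Assumption 1: if $\mathcal{D}\subset\{g=0\}$ then $\mathcal{D}=\{g=0\}$; and if $\mathcal{D}\subset\{h=0\}$ then $\mathcal{D}=\{h=0\}$. Assumption 2: either $\{g=0\}\subset\{h\le 0\}$ or $\{g=0\}\subset\{h\ge 0\}$; and either $\{h=0\}\subset\{g\le 0\}$ or $\{h=0\}\subset\{g\ge 0\}$. Assumption 3: $f,g,h$ are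 non-constant functions, and $\mathcal{D}\neq\emptyset$, $\mathcal{D}\neq\{g\le 0\}$, $\mathcal{D}\neq\{h\le 0\}$. Assumption 4: each of the functions $g,h,-g,-h$ satisfies Slater's condition, i.e. takes a strictly negative value at some point (so $g$ and $h$ each take both positive and negative values). Assumption 5: if, after a coordinate transformation (invertible affine change of variables), $g,h$ become functions of a single variable $x_1\in\mathbb{R}$, one of them of the form $-x_1^2+1$ and the other of the form $\bar c_1x_1+\bar c_0$ with $\bar c_1>0$, then $\bar c_0\neq\pm\bar c_1$. *)

theory Defs
  imports "HOL-Analysis.Analysis"
begin

definition feasible_set :: "(real ^ 'n \<Rightarrow> real) \<Rightarrow> (real ^ 'n \<Rightarrow> real) \<Rightarrow> (real ^ 'n) set" where
  "feasible_set g h = {x. g x \<le> 0} \<inter> {x. h x \<le> 0}"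

definition assumption1 :: "(real ^ 'n \<Rightarrow> real) \<Rightarrow> (real ^ 'n \<Rightarrow> real) \<Rightarrow> bool" where
  "assumption1 g h \<longleftrightarrow>
     (feasible_set g h \<subseteq> {x. g x = 0} \<longrightarrow> feasible_set g h = {x. g x = 0}) \<and>
     (feasible_set g h \<subseteq> {x. h x = 0} \<longrightarrow> feasible_set g h = {x. h x = 0})"

definition assumption2 :: "(real ^ 'n \<Rightarrow> real) \<Rightarrow> (real ^ 'n \<Rightarrow> real) \<Rightarrow> bool" where
  "assumption2 g h \<longleftrightarrow>
     ({x. g x = 0} \<subseteq> {x. h x \<le> 0} \<or> {x. g x = 0} \<subseteq> {x. h x \<ge> 0}) \<and>
     ({x. h x = 0} \<subseteq> {x. g x \<le> 0} \<or> {x. h x = 0} \<subseteq> {x. g x \<ge> 0})"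

definition assumption3 ::
  "(real ^ 'n \<Rightarrow> real) \<Rightarrow> (real ^ 'n \<Rightarrow> real) \<Rightarrow> (real ^ 'n \<Rightarrow> real) \<Rightarrow> bool" where
  "assumption3 f g h \<longleftrightarrow>
     \<not> f constant_on UNIV \<and> \<not> g constant_on UNIV \<and> \<not> h constant_on UNIV \<and>
     feasible_set g h \<noteq> {} \<and>
     feasible_set g h \<noteq> {x. g x \<le> 0} \<and>
     feasible_set g h \<noteq> {x. h x \<le> 0}"

definition slater :: "(real ^ 'n \<Rightarrow> real) \<Rightarrow> bool" where
  "slater \<phi> \<longleftrightarrow> (\<exists>x. \<phi> x < 0)"

definition assumption4 :: "(real ^ 'n \<Rightarrow> real) \<Rightarrow> (real ^ 'n \<Rightarrow> real) \<Rightarrow> bool" where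
  "assumption4 g h \<longleftrightarrow>
     slater g \<and> slater h \<and> slater (\<lambda>x. - g x) \<and> slater (\<lambda>x. - h x)"

text \<open>The index type has no distinguished first element, so the variable \<open>x\<^sub>1\<close> is rendered as an
  arbitrary coordinate \<open>i\<close>; permuting coordinates is itself an invertible affine change of
  variables. The two functions have exactly the displayed forms after the substitution
  \<open>x = P y + p\<close>; their values are not rescaled.\<close>

definition parabola_line_form ::
  "(real ^ 'n \<Rightarrow> real) \<Rightarrow> (real ^ 'n \<Rightarrow> real) \<Rightarrow>
   real ^ 'n ^ 'n \<Rightarrow> real ^ 'n \<Rightarrow> 'n \<Rightarrow> real \<Rightarrow> real \<Rightarrow> bool" where
  "parabola_line_form u v P p i c1 c0 \<longleftrightarrow>
     (\<forall>y. u (P *v y + p) = - (y $ i)\<^sup>2 + 1) \<and>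
     (\<forall>y. v (P *v y + p) = c1 * y $ i + c0)"

definition assumption5 :: "(real ^ 'n \<Rightarrow> real) \<Rightarrow> (real ^ 'n \<Rightarrow> real) \<Rightarrow> bool" where
  "assumption5 g h \<longleftrightarrow>
     (\<forall>P p i c1 c0.
        invertible P \<and> c1 > 0 \<and>
        (parabola_line_form g h P p i c1 c0 \<or> parabola_line_form h g P p i c1 c0) \<longrightarrow>
        c0 \<noteq> c1 \<and> c0 \<noteq> - c1)"

end

theory Submission imports Defs "HOL-Real_Asymp.Real_Asymp"
begin

text \<open>After a small perturbation, a point violating the claim gives \<open>g > 0\<close> and \<open>h > 0\<close>, and
  Assumption 3 gives points of the sign patterns \<open>(-, +)\<close> and \<open>(+, -)\<close>. If the pattern \<open>(-, -)\<close>
  occurs as well, all four do, and each alternative of Assumption 2 says that, for suitable signs,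
  neither of \<open>\<phi> = \<plusminus>g\<close>, \<open>\<psi> = \<plusminus>h\<close> vanishes where the other is positive; otherwise Assumption 1
  forces \<open>{g = 0} = {h = 0}\<close> and the same holds. Such \<open>\<phi>\<close>, \<open>\<psi>\<close> cannot attain the three sign
  patterns \<open>(+, +)\<close>, \<open>(+, -)\<close>, \<open>(-, +)\<close>: in the plane through the three points, \<open>\<phi>\<close> is
  strictly convex and \<open>\<psi>\<close> affine along one axis, \<open>\<phi>\<close> affine and \<open>\<psi>\<close> strictly convex along the
  other, so that on a long segment parallel to the second axis \<open>\<phi>\<close> stays positive while
  \<open>\<psi>\<close> changes sign.\<close>

section \<open>Quadratic functions: restriction to planes and perturbation of zeros\<close>

definition quadratic_fun :: "(real ^ 'n \<Rightarrow> real) \<Rightarrow> bool" where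
  "quadratic_fun \<phi> \<longleftrightarrow> (\<exists>M m k. \<forall>x. \<phi> x = x \<bullet> (M *v x) + 2 * (m \<bullet> x) + k)"

lemma quadratic_fun_uminus:
  assumes "quadratic_fun \<phi>"
  shows "quadratic_fun (\<lambda>x. - \<phi> x)"
proof -
  obtain M m k where "\<And>x. \<phi> x = x \<bullet> (M *v x) + 2 * (m \<bullet> x) + k"
    using assms unfolding quadratic_fun_def by blast
  then have "- \<phi> x = x \<bullet> ((- M) *v x) + 2 * ((- m) \<bullet> x) + (- k)" for x
    by (simp add: scaleR_matrix_vector_assoc [symmetric, of "-1", simplified])
  then show ?thesis
    unfolding quadratic_fun_def by blast
qed

lemma continuous_on_quadratic_fun:
  assumes "quadratic_fun \<phi>"
  shows "continuous_on UNIV \<phi>"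
proof -
  obtain M m k where "\<And>x. \<phi> x = x \<bullet> (M *v x) + 2 * (m \<bullet> x) + k"
    using assms unfolding quadratic_fun_def by blast
  then have "\<phi> = (\<lambda>x. x \<bullet> (M *v x) + 2 * (m \<bullet> x) + k)"
    by blast
  then show ?thesis
    by (simp only:) (intro continuous_intros linear_continuous_on matrix_vector_mul_bounded_linear)
qed

lemma quadratic_fun_on_plane:
  assumes "quadratic_fun \<phi>"
  obtains a b e l m where
    "\<And>s t. \<phi> (x + s *\<^sub>R u + t *\<^sub>R v) = a * s\<^sup>2 + b * s * t + e * t\<^sup>2 + l * s + m * t + \<phi> x"
proof -
  obtain M w k where M: "\<And>x. \<phi> x = x \<bullet> (M *v x) + 2 * (w \<bullet> x) + k"
    using assms unfolding quadratic_fun_def by blast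
  have "\<phi> (x + s *\<^sub>R u + t *\<^sub>R v) =
      (u \<bullet> (M *v u)) * s\<^sup>2 + (u \<bullet> (M *v v) + v \<bullet> (M *v u)) * s * t + (v \<bullet> (M *v v)) * t\<^sup>2
      + (x \<bullet> (M *v u) + u \<bullet> (M *v x) + 2 * (w \<bullet> u)) * s
      + (x \<bullet> (M *v v) + v \<bullet> (M *v x) + 2 * (w \<bullet> v)) * t + \<phi> x" for s t
    unfolding M
    by (simp add: matrix_vector_right_distrib matrix_vector_mult_scaleR inner_add_left
        inner_add_right algebra_simps power2_eq_square)
  then show ?thesis
    using that by blast
qed

text \<open>On the line from a zero \<open>y\<close> to \<open>z\<close>, \<open>\<phi>\<close> is a
  one-variable quadratic vanishing at \<open>s = 0\<close> and negative at \<open>s = 1\<close>. If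
  it were nonnegative on both sides of \<open>0\<close>, it would be convex with its minimum there
  and could not reach \<open>\<phi> z < 0\<close>. This makes a weak inequality strict without
  leaving an open condition \<open>S\<close>.\<close>

lemma quadratic_fun_neg_near_zero:
  assumes \<phi>: "quadratic_fun \<phi>" and S: "open S" "y \<in> S" and "\<phi> y \<le> 0" and z: "\<phi> z < 0"
  obtains w where "w \<in> S" "\<phi> w < 0"
proof (cases "\<phi> y < 0")
  case True
  then show ?thesis
    using S that by blast
next
  case False
  then have y: "\<phi> y = 0"
    using assms by simp
  obtain a b e l m where "\<phi> (y + s *\<^sub>R (z - y) + t *\<^sub>R 0) =
      a * s\<^sup>2 + b * s * t + e * t\<^sup>2 + l * s + m * t + \<phi> y" for s t
    using quadratic_fun_on_plane [OF \<phi>, of y "z - y" 0] by blast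
  from this [of _ 0] have L: "\<phi> (y + s *\<^sub>R (z - y)) = a * s\<^sup>2 + l * s + \<phi> y" for s
    by simp
  have "((\<lambda>s. y + s *\<^sub>R (z - y)) \<longlongrightarrow> y + 0 *\<^sub>R (z - y)) (nhds (0::real))"
    by (intro tendsto_intros filterlim_ident)
  then have "\<forall>\<^sub>F s in nhds (0::real). y + s *\<^sub>R (z - y) \<in> S"
    using S by (simp add: topological_tendstoD)
  then obtain d where d: "d > 0" "\<And>s. \<bar>s\<bar> < d \<Longrightarrow> y + s *\<^sub>R (z - y) \<in> S"
    by (auto simp: eventually_nhds_metric dist_real_def)
  \<comment> \<open>The bound \<open>t < d\<close> keeps both test points in \<open>S\<close>, and
    \<open>t \<le> 1\<close> gives \<open>a * t\<^sup>2 \<le> a * t\<close>, which carries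
    nonnegativity at \<open>t\<close> over to \<open>a + l\<close>.\<close>
  define t where "t = min (d / 2) 1"
  have t: "0 < t" "t < d" "t \<le> 1"
    using d by (auto simp: t_def)
  have in_S: "y + t *\<^sub>R (z - y) \<in> S" "y + (- t) *\<^sub>R (z - y) \<in> S"
    using d(2) [of t] d(2) [of "- t"] t by auto
  have "\<phi> (y + t *\<^sub>R (z - y)) < 0 \<or> \<phi> (y + (- t) *\<^sub>R (z - y)) < 0"
  proof (rule ccontr)
    assume "\<not> ?thesis"
    then have ge: "a * t\<^sup>2 + l * t \<ge> 0" "a * t\<^sup>2 - l * t \<ge> 0"
      using L [of t] L [of "- t"] y by auto
    have neg: "a + l < 0"
      using L [of 1] z y by simp
    from ge have "a * t\<^sup>2 \<ge> 0" by linarith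
    then have "a \<ge> 0"
      using t by (simp add: zero_le_mult_iff)
    then have "a * t\<^sup>2 \<le> a * t"
      using t by (simp add: power2_eq_square mult_left_le mult_left_mono)
    then have "(a + l) * t \<ge> 0"
      using ge by (simp add: algebra_simps)
    then show False
      using neg t by (simp add: zero_le_mult_iff)
  qed
  then show ?thesis
    using that in_S by blast
qed

section \<open>Sign changes of quadratic polynomials in one variable\<close>

lemma sign_change_between:
  fixes G :: "real \<Rightarrow> real"
  assumes "continuous_on UNIV G" and "G u < 0" and "G v > 0"
  obtains t where "t \<in> closed_segment u v" "G t = 0"
proof -
  have "is_interval (G ` closed_segment u v)"
    using assms(1) by (intro connected_continuous_image [THEN is_interval_connected_1 [THEN iffD2]])
      (auto intro: continuous_on_subset)
  then have "0 \<in> G ` closed_segment u v"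
    by (rule mem_is_interval_1_I [of _ "G u" "G v"]) (use assms in auto)
  then show ?thesis
    using that by force
qed

lemma quadratic_eventually_pos:
  fixes a b c :: real
  assumes "a > 0"
  shows "\<forall>\<^sub>F t in at_top. a * t\<^sup>2 + b * t + c > 0"
  using assms by real_asymp

text \<open>\<open>G\<close> has a zero \<open>r\<close> between \<open>0\<close> and
  \<open>1\<close>, where \<open>F\<close> must be nonpositive. Hence \<open>F\<close> is strictly
  convex and positive outside the unit interval, so \<open>G\<close> keeps its sign on each of the
  two outer rays. Opposite signs at both infinities exclude a square term in
  \<open>G\<close>.\<close>

lemma convex_and_affine_of_sign_change:
  fixes a b c a' b' c' :: real
  defines "F \<equiv> \<lambda>t. a * t\<^sup>2 + b * t + c" and "G \<equiv> \<lambda>t. a' * t\<^sup>2 + b' * t + c'"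
  assumes nz: "\<And>t. F t > 0 \<Longrightarrow> G t \<noteq> 0"
    and ends: "F 0 > 0" "F 1 > 0" "G 0 > 0" "G 1 < 0"
  shows "a > 0 \<and> a' = 0"
proof -
  have cont: "continuous_on UNIV G"
    unfolding G_def by (intro continuous_intros)
  obtain r where "r \<in> closed_segment 1 0" "G r = 0"
    using sign_change_between [OF cont ends(4,3)] .
  then have r: "0 \<le> r" "r \<le> 1" "F r \<le> 0"
    using nz [of r] by (auto simp: closed_segment_eq_real_ivl not_less [symmetric])
  have c: "c > 0" "a + b + c > 0"
    using ends by (simp_all add: F_def)
  have "r \<noteq> 0" "r \<noteq> 1"
    using r ends by auto
  then have r01: "0 < r" "r < 1"
    using r by auto
  \<comment> \<open>\<open>a * (r * (1 - r))\<close> is the height of the chord of \<open>F\<close>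
    over \<open>[0, 1]\<close> above the graph at \<open>r\<close>; the chord is positive and
    \<open>F r \<le> 0\<close>.\<close>
  have id: "a * (r * (1 - r)) = (1 - r) * c + r * (a + b + c) - F r"
    unfolding F_def by (simp add: algebra_simps power2_eq_square)
  have "(1 - r) * c + r * (a + b + c) > 0"
    using r01 c by (simp add: add_pos_pos)
  then have "a * (r * (1 - r)) > 0"
    using id r by linarith
  then have a: "a > 0"
    by (rule zero_less_mult_pos2) (use r01 in simp)
  have Fpos: "F t > 0" if "t \<le> 0 \<or> t \<ge> 1" for t
  proof -
    \<comment> \<open>Interpolation of \<open>F\<close> at \<open>0\<close>, \<open>r\<close>, resp. at \<open>r\<close>, \<open>1\<close>: outside \<open>[0, 1]\<close> no term is negative.\<close>
    have 0: "r * F t = a * r * (t * (t - r)) + (r - t) * c + t * F r"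
      unfolding F_def by (simp add: algebra_simps power2_eq_square)
    have 1: "(1 - r) * F t = a * (1 - r) * ((t - 1) * (t - r)) + (1 - t) * F r + (t - r) * (a + b + c)"
      unfolding F_def by (simp add: algebra_simps power2_eq_square)
    show ?thesis
    proof (cases "t \<le> 0")
      case True
      have "t * (t - r) \<ge> 0" "t * F r \<ge> 0" "(r - t) * c > 0"
        using True r r01 c by (auto intro: mult_nonpos_nonpos)
      moreover have "a * r \<ge> 0"
        using a r01 by simp
      ultimately have "r * F t > 0"
        unfolding 0 by (simp add: add_pos_nonneg add_nonneg_pos)
      then show ?thesis
        by (rule zero_less_mult_pos) (use r01 in simp)
    next
      case False
      then have "(t - 1) * (t - r) \<ge> 0" "(1 - t) * F r \<ge> 0" "(t - r) * (a + b + c) > 0"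
        using that r r01 c by (auto intro: mult_nonpos_nonpos)
      moreover have "a * (1 - r) \<ge> 0"
        using a r01 by simp
      ultimately have "(1 - r) * F t > 0"
        unfolding 1 by (simp add: add_nonneg_pos)
      then show ?thesis
        by (rule zero_less_mult_pos) (use r01 in simp)
    qed
  qed
  have Gneg: "G t < 0" if "t \<ge> 1" for t
  proof (rule ccontr)
    assume "\<not> ?thesis"
    moreover have "G t \<noteq> 0"
      using nz Fpos that by blast
    ultimately have "G t > 0"
      by simp
    then obtain s where "s \<in> closed_segment 1 t" "G s = 0"
      using sign_change_between [OF cont ends(4)] by blast
    then show False
      using nz Fpos [of s] that by (auto simp: closed_segment_eq_real_ivl)
  qed
  have Gpos: "G t > 0" if "t \<le> 0" for t
  proof (rule ccontr)
    assume "\<not> ?thesis"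
    moreover have "G t \<noteq> 0"
      using nz Fpos that by blast
    ultimately have "G t < 0"
      by simp
    then obtain s where "s \<in> closed_segment t 0" "G s = 0"
      using sign_change_between [OF cont _ ends(3)] by blast
    then show False
      using nz Fpos [of s] that by (auto simp: closed_segment_eq_real_ivl)
  qed
  have "\<not> a' > 0"
  proof
    assume "a' > 0"
    then have "\<forall>\<^sub>F t in at_top. G t > 0 \<and> t \<ge> 1"
      unfolding G_def by (intro eventually_conj quadratic_eventually_pos eventually_ge_at_top)
    then obtain t where "G t > 0" "t \<ge> 1"
      by (metis (mono_tags, lifting) eventually_happens trivial_limit_at_top_linorder)
    then show False
      using Gneg [of t] by simp
  qed
  moreover have "\<not> a' < 0"
  proof
    assume "a' < 0"
    then have "\<forall>\<^sub>F t in at_top. (- a') * t\<^sup>2 + b' * t + (- c') > 0 \<and> t \<ge> 0"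
      by (intro eventually_conj quadratic_eventually_pos eventually_ge_at_top) simp
    then obtain t where "(- a') * t\<^sup>2 + b' * t + (- c') > 0" "t \<ge> 0"
      by (metis (mono_tags, lifting) eventually_happens trivial_limit_at_top_linorder)
    then show False
      using Gpos [of "- t"] by (simp add: G_def)
  qed
  ultimately show ?thesis
    using a by simp
qed

section \<open>Excluding three sign patterns in a plane, then in general\<close>

lemma no_three_sign_patterns_on_plane:
  fixes a b e l m k a' b' e' l' m' k' :: real
  defines "F \<equiv> \<lambda>s t. a * s\<^sup>2 + b * s * t + e * t\<^sup>2 + l * s + m * t + k"
    and "G \<equiv> \<lambda>s t. a' * s\<^sup>2 + b' * s * t + e' * t\<^sup>2 + l' * s + m' * t + k'"
  assumes nzG: "\<And>s t. F s t > 0 \<Longrightarrow> G s t \<noteq> 0" and nzF: "\<And>s t. G s t > 0 \<Longrightarrow> F s t \<noteq> 0"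
    and pp: "F 0 0 > 0" "G 0 0 > 0" and pn: "F 1 0 > 0" "G 1 0 < 0" and np: "F 0 1 < 0" "G 0 1 > 0"
  shows False
proof -
  have "a > 0 \<and> a' = 0"
    by (rule convex_and_affine_of_sign_change [where b = l and c = k and b' = l' and c' = k'])
      (use nzG [of _ 0] pp pn in \<open>auto simp: F_def G_def\<close>)
  then have a: "a > 0" "a' = 0"
    by auto
  \<comment> \<open>The same argument along the other axis, with \<open>F\<close> and
    \<open>G\<close> exchanged.\<close>
  have "e' > 0 \<and> e = 0"
    by (rule convex_and_affine_of_sign_change [where b = m' and c = k' and b' = m and c' = k])
      (use nzF [of 0] pp np in \<open>auto simp: F_def G_def\<close>)
  then have e: "e' > 0" "e = 0"
    by auto
  \<comment> \<open>With \<open>\<bar>b\<bar> * \<epsilon> < a\<close>, the mixed term cannot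
    outweigh \<open>a * s\<^sup>2\<close> on the rays \<open>t = \<plusminus>\<epsilon> * s\<close>,
    so \<open>F\<close> is eventually positive on both. The summand \<open>1\<close> covers
    \<open>b = 0\<close>.\<close>
  define \<epsilon> where "\<epsilon> = a / (2 * (\<bar>b\<bar> + 1))"
  have \<epsilon>: "\<epsilon> > 0" "\<bar>b\<bar> * \<epsilon> < a"
    using a by (auto simp: \<epsilon>_def field_simps intro!: add_nonneg_pos)
  have "\<bar>b * \<epsilon>\<bar> < a"
    using \<epsilon> by (simp add: abs_mult)
  then have coeffs: "a + b * \<epsilon> > 0" "a - b * \<epsilon> > 0" "e' * \<epsilon>\<^sup>2 > 0"
    using \<epsilon> e by auto
  have "\<forall>\<^sub>F s in at_top. (a + b * \<epsilon>) * s\<^sup>2 + (l + m * \<epsilon>) * s + k > 0 \<and>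
      (a - b * \<epsilon>) * s\<^sup>2 + (l - m * \<epsilon>) * s + k > 0 \<and>
      e' * \<epsilon>\<^sup>2 * s\<^sup>2 + l' * s + k' > 0 \<and> s \<ge> 1"
    using coeffs by (intro eventually_conj quadratic_eventually_pos eventually_ge_at_top)
  then obtain s where s: "(a + b * \<epsilon>) * s\<^sup>2 + (l + m * \<epsilon>) * s + k > 0"
    "(a - b * \<epsilon>) * s\<^sup>2 + (l - m * \<epsilon>) * s + k > 0" "e' * \<epsilon>\<^sup>2 * s\<^sup>2 + l' * s + k' > 0" "s \<ge> 1"
    by (metis (mono_tags, lifting) eventually_happens trivial_limit_at_top_linorder)
  have Fpos: "F s (\<epsilon> * s) > 0" "F s (- (\<epsilon> * s)) > 0"
    using s e by (auto simp: F_def algebra_simps power2_eq_square)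
  have Fpos': "F s t > 0" if "\<bar>t\<bar> \<le> \<epsilon> * s" for t
  proof -
    \<comment> \<open>\<open>F s\<close> is affine, since \<open>e = 0\<close>.\<close>
    have "F s t * (2 * (\<epsilon> * s)) =
        (\<epsilon> * s - t) * F s (- (\<epsilon> * s)) + (\<epsilon> * s + t) * F s (\<epsilon> * s)"
      using e by (simp add: F_def algebra_simps power2_eq_square)
    also have "\<dots> > 0"
    proof (cases "t = \<epsilon> * s")
      case True
      then show ?thesis
        using Fpos s \<epsilon> by simp
    next
      case False
      then show ?thesis
        using Fpos that by (intro add_pos_nonneg mult_pos_pos mult_nonneg_nonneg) auto
    qed
    finally show ?thesis
      by (rule zero_less_mult_pos2) (use s \<epsilon> in simp)
  qed
  \<comment> \<open>Since \<open>a' = 0\<close>, \<open>G\<close> is affine on the first axis; it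
    falls from positive at \<open>0\<close> to negative at \<open>1\<close> and stays negative for
    \<open>s \<ge> 1\<close>.\<close>
  have "G s 0 < 0"
  proof -
    have "G s 0 = (1 - s) * G 0 0 + s * G 1 0"
      using a by (simp add: G_def algebra_simps)
    also have "\<dots> < 0"
      using s pp pn by (smt (verit) mult_nonneg_nonneg mult_nonpos_nonneg mult_pos_neg)
    finally show ?thesis .
  qed
  have cont: "continuous_on UNIV (G s)"
    unfolding G_def by (intro continuous_intros)
  \<comment> \<open>\<open>F\<close> is positive on the whole segment, so \<open>G\<close> has no
    zero there and keeps the sign it has at the midpoint \<open>t = 0\<close>.\<close>
  have Gneg: "G s t < 0" if "\<bar>t\<bar> \<le> \<epsilon> * s" for t
  proof (rule ccontr)
    assume "\<not> ?thesis"
    then have "G s t > 0"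
      using nzG [OF Fpos' [OF that]] by simp
    then obtain r where "r \<in> closed_segment 0 t" "G s r = 0"
      using sign_change_between [OF cont \<open>G s 0 < 0\<close>] by blast
    then show False
      using nzG [OF Fpos', of r] that by (auto simp: closed_segment_eq_real_ivl split: if_splits)
  qed
  \<comment> \<open>Adding the values at \<open>t = \<plusminus>\<epsilon> s\<close> cancels the mixed term of \<open>G\<close>.\<close>
  have "G s (\<epsilon> * s) + G s (- (\<epsilon> * s)) = 2 * (e' * \<epsilon>\<^sup>2 * s\<^sup>2 + l' * s + k')"
    using a by (simp add: G_def algebra_simps power2_eq_square)
  moreover have "G s (\<epsilon> * s) < 0" "G s (- (\<epsilon> * s)) < 0"
    using Gneg s \<epsilon> by auto
  ultimately show False
    using s by simp
qed

lemma no_three_sign_patterns: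
  assumes \<phi>: "quadratic_fun \<phi>" and \<psi>: "quadratic_fun \<psi>"
    and nz: "\<And>x. \<phi> x > 0 \<Longrightarrow> \<psi> x \<noteq> 0" "\<And>x. \<psi> x > 0 \<Longrightarrow> \<phi> x \<noteq> 0"
    and pp: "\<phi> x > 0" "\<psi> x > 0" and pn: "\<phi> q > 0" "\<psi> q < 0" and np: "\<phi> p < 0" "\<psi> p > 0"
  shows False
proof -
  define P where "P s t = x + s *\<^sub>R (q - x) + t *\<^sub>R (p - x)" for s t
  have P: "P 0 0 = x" "P 1 0 = q" "P 0 1 = p"
    by (simp_all add: P_def)
  obtain a b e l m where F:
    "\<And>s t. \<phi> (P s t) = a * s\<^sup>2 + b * s * t + e * t\<^sup>2 + l * s + m * t + \<phi> x"
    unfolding P_def using quadratic_fun_on_plane [OF \<phi>] by blast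
  obtain a' b' e' l' m' where G:
    "\<And>s t. \<psi> (P s t) = a' * s\<^sup>2 + b' * s * t + e' * t\<^sup>2 + l' * s + m' * t + \<psi> x"
    unfolding P_def using quadratic_fun_on_plane [OF \<psi>] by blast
  \<comment> \<open>Folding \<open>F\<close> and \<open>G\<close> turns the polynomials back into
    values of \<open>\<phi>\<close> and \<open>\<psi>\<close> at \<open>P s t\<close>; the three
    corners then become \<open>x\<close>, \<open>q\<close>, \<open>p\<close>.\<close>
  show False
    by (rule no_three_sign_patterns_on_plane
        [of a b e l m "\<phi> x" a' b' e' l' m' "\<psi> x", folded F G, unfolded P])
      (use nz pp pn np in auto)
qed

section \<open>Sign patterns of \<open>g\<close> and \<open>h\<close> under the assumptions\<close>

lemma no_common_positive_point:
  assumes g: "quadratic_fun g" and h: "quadratic_fun h"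
    and A1: "assumption1 g h" and A2: "assumption2 g h"
    and D: "feasible_set g h \<noteq> {}" "feasible_set g h \<noteq> {x. g x \<le> 0}"
      "feasible_set g h \<noteq> {x. h x \<le> 0}"
    and A4: "assumption4 g h"
    and x: "g x > 0" "h x > 0"
  shows False
proof -
  have open_pos: "open {x. g x > 0}" "open {x. h x > 0}" "open {x. g x < 0}" "open {x. h x < 0}"
    using continuous_on_quadratic_fun [OF g] continuous_on_quadratic_fun [OF h]
    by (auto intro!: open_Collect_less continuous_intros)
  obtain zg zh where z: "g zg < 0" "h zh < 0"
    using A4 by (auto simp: assumption4_def slater_def)
  obtain p' where p': "g p' \<le> 0" "h p' > 0"
    using D(2) by (force simp: feasible_set_def)
  obtain p where p: "g p < 0" "h p > 0"
    using quadratic_fun_neg_near_zero [OF g open_pos(2) _ p'(1) z(1)] p'(2) by auto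
  obtain q' where q': "h q' \<le> 0" "g q' > 0"
    using D(3) by (force simp: feasible_set_def)
  obtain q where q: "g q > 0" "h q < 0"
    using quadratic_fun_neg_near_zero [OF h open_pos(1) _ q'(1) z(2)] q'(2) by auto
  show False
  proof (cases "\<exists>d. g d < 0 \<and> h d < 0")
    case True
    then obtain d where d: "g d < 0" "h d < 0"
      by blast
    \<comment> \<open>\<open>g\<close> is negated exactly when it is \<open>\<ge> 0\<close> on the
      zeros of \<open>h\<close>, and \<open>h\<close> exactly when it is \<open>\<ge> 0\<close> on
      the zeros of \<open>g\<close>. The three of \<open>x\<close>, \<open>p\<close>,
      \<open>q\<close>, \<open>d\<close> used are those where the resulting functions are not both
      negative.\<close>
    consider "\<And>y. g y = 0 \<Longrightarrow> h y \<le> 0" "\<And>y. h y = 0 \<Longrightarrow> g y \<le> 0"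
      | "\<And>y. g y = 0 \<Longrightarrow> h y \<le> 0" "\<And>y. h y = 0 \<Longrightarrow> g y \<ge> 0"
      | "\<And>y. g y = 0 \<Longrightarrow> h y \<ge> 0" "\<And>y. h y = 0 \<Longrightarrow> g y \<le> 0"
      | "\<And>y. g y = 0 \<Longrightarrow> h y \<ge> 0" "\<And>y. h y = 0 \<Longrightarrow> g y \<ge> 0"
      using A2 unfolding assumption2_def by blast
    then show False
    proof cases
      case 1
      show False
        by (rule no_three_sign_patterns [OF g h, of x q p]) (use 1 x p q in force)+
    next
      case 2
      show False
        by (rule no_three_sign_patterns [OF quadratic_fun_uminus [OF g] h, of p d x]) (use 2 x p d in force)+
    next
      case 3
      show False
        by (rule no_three_sign_patterns [OF g quadratic_fun_uminus [OF h], of q x d]) (use 3 x q d in force)+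
    next
      case 4
      show False
        by (rule no_three_sign_patterns [OF quadratic_fun_uminus [OF g] quadratic_fun_uminus [OF h], of d p q])
          (use 4 d p q in force)+
    qed
  next
    case False
    \<comment> \<open>If one function were negative at \<open>d\<close> and the other only
      nonpositive, a perturbation inside the open negativity set of the first would make both
      negative.\<close>
    have "g d = 0 \<and> h d = 0" if "g d \<le> 0" "h d \<le> 0" for d
    proof -
      have "\<not> g d < 0"
        using quadratic_fun_neg_near_zero [OF h open_pos(3) _ that(2) z(2)] False by auto
      moreover have "\<not> h d < 0"
        using quadratic_fun_neg_near_zero [OF g open_pos(4) _ that(1) z(1)] False by auto
      ultimately show ?thesis
        using that by auto
    qed
    then have "feasible_set g h = {x. g x = 0}" "feasible_set g h = {x. h x = 0}"
      using A1 unfolding assumption1_def by (auto simp: feasible_set_def)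
    then have "g y = 0 \<longleftrightarrow> h y = 0" for y
      by blast
    then show False
      using no_three_sign_patterns [OF g h _ _ x q p] by force
  qed
qed

theorem theorem3p1:
  fixes A B C :: "real ^ 'n ^ 'n"
    and a b c :: "real ^ 'n"
    and a0 b0 c0 :: real
    and f g h :: "real ^ 'n \<Rightarrow> real"
  assumes "transpose A = A" and "transpose B = B" and "transpose C = C"
    and "\<And>x. f x = x \<bullet> (A *v x) + 2 * (a \<bullet> x) + a0"
    and "\<And>x. g x = x \<bullet> (B *v x) + 2 * (b \<bullet> x) + b0"
    and "\<And>x. h x = x \<bullet> (C *v x) + 2 * (c \<bullet> x) + c0"
    and "assumption1 g h"
    and "assumption2 g h"
    and "assumption3 f g h"
    and "assumption4 g h"
    and "assumption5 g h"
  shows "\<not> (\<exists>x. g x > 0 \<and> h x \<ge> 0) \<and>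
         \<not> (\<exists>x. g x \<ge> 0 \<and> h x > 0) \<and>
         ({x. g x > 0} \<inter> {x. h x \<ge> 0}) \<union> ({x. g x \<ge> 0} \<inter> {x. h x > 0}) = {}"
proof -
  have g: "quadratic_fun g" and h: "quadratic_fun h"
    using assms(5,6) unfolding quadratic_fun_def by blast+
  have open_pos: "open {x. g x > 0}" "open {x. h x > 0}"
    using continuous_on_quadratic_fun [OF g] continuous_on_quadratic_fun [OF h]
    by (auto intro!: open_Collect_less continuous_intros)
  obtain zg zh where z: "- g zg < 0" "- h zh < 0"
    using assms(10) by (auto simp: assumption4_def slater_def)
  have pos: "\<not> (g x > 0 \<and> h x > 0)" for x
    using no_common_positive_point [OF g h assms(7,8) _ _ _ assms(10)] assms(9)
    unfolding assumption3_def by blast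
  \<comment> \<open>Perturbing for \<open>- h\<close> inside the open set where \<open>g\<close> is
    positive makes \<open>h\<close> strictly positive too.\<close>
  have "\<not> (g x > 0 \<and> h x \<ge> 0)" for x
    using quadratic_fun_neg_near_zero [OF quadratic_fun_uminus [OF h] open_pos(1) _ _ z(2), of x] pos
    by auto
  moreover have "\<not> (g x \<ge> 0 \<and> h x > 0)" for x
    using quadratic_fun_neg_near_zero [OF quadratic_fun_uminus [OF g] open_pos(2) _ _ z(1), of x] pos
    by auto
  ultimately show ?thesis
    by blast
qed

end
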